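(* Let $(X,d)$ be a compact metric space, let $f\colon X\to X$ be a homeomorphism, and let $\Lambda$ be a closed $f$-invariant subset of $X$. Suppose that (i) ${\rm int}[\Lambda]\ne\emptyset$; (ii) $f|_\Lambda\colon\Lambda\to\Lambda$ is chain transitive; (iii) $f$ has shadowing and L-shadowing on $B_b(\Lambda)$ for some $b>0$. Then $\Lambda$ is clopen in $X$; therefore, if furthermore $X$ is connected, then $X=\Lambda$ and $f$ is a mixing homeomorphism.
   Context: A subset $S\subset X$ is $f$-invariant if $f(S)\subset S$. ${\rm int}[S]$ is the interior of $S$. For $r>0$, $B_r(S)=\{x\in X: d(x,S)\le r\}$, where $d(x,S)=\inf_{y\in S}d(x,y)$. For a continuous map $f\colon X\to X$ and $\delta>0$, a $\delta$-chain of $f$ is a finite sequence $(x_i)_{i=0}^k$ in $X$, $k\ge1$, with $d(f(x_i),x_{i+1})\le\delta$ for $0\le i\le k-1$. Write $x\rightarrow y$ if for every $\delta>0$ there is a $\delta$-chain $(x_i)_{i=0}^k$ of $f$ with $x_0=x$, $x_k=y$. The map $f$ is chain transitive if $x\rightarrow y$ for all $x,y\in X$ (for $f|_\Lambda$ this is applied to the space $\Lambda$ with the restricted metric). $f$ has shadowing on $S\subset X$ if for any $\epsilon>0$ there is $\delta>0$ such that for every $\delta$-chain $(x_i)_{i=0}^k$ of $f$ with all $x_i\in S$ there is $x\in X$ with $\sup_{0\le i\le k}d(x_i,f^i(x))\le\epsilon$. For a homeomorphism $f$, a $\delta$-limit-pseudo orbit of $f$ is a bi-infinite sequence $(x_i)_{i\in\mathbb{Z}}$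 in $X$ with $\sup_{i\in\mathbb{Z}}d(f(x_i),x_{i+1})\le\delta$ and $d(f(x_i),x_{i+1})\to0$ as $i\to-\infty$ and as $i\to+\infty$. $f$ has L-shadowing on $S\subset X$ if for any $\epsilon>0$ there is $\delta>0$ such that for every $\delta$-limit-pseudo orbit $(x_i)_{i\in\mathbb{Z}}$ of $f$ with all $x_i\in S$ there is $x\in X$ with $\sup_{i\in\mathbb{Z}}d(x_i,f^i(x))\le\epsilon$ and $d(x_i,f^i(x))\to0$ as $i\to-\infty$ and as $i\to+\infty$. $f$ is mixing if for any nonempty open $U,V\subset X$ there is $j\ge0$ such that $f^i(U)\cap V\ne\emptyset$ for all $i\ge j$. *)

theory Defs
  imports "HOL-Analysis.Analysis"
begin

text \<open>
  The compact metric space \<open>X\<close> is the universe of a type of class \<open>metric_space\<close>,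
  with compactness an explicit hypothesis. Bounds of the form
  \<open>sup\<^sub>i d(x\<^sub>i, y\<^sub>i) \<le> \<epsilon>\<close> are written as \<open>d(x\<^sub>i, y\<^sub>i) \<le> \<epsilon>\<close> for all \<open>i\<close>.
\<close>

definition self_homeomorphism :: "('a::topological_space \<Rightarrow> 'a) \<Rightarrow> bool" where
  "self_homeomorphism f \<longleftrightarrow> (\<exists>g. homeomorphism UNIV UNIV f g)"

definition invariant_set :: "('a \<Rightarrow> 'a) \<Rightarrow> 'a set \<Rightarrow> bool" where
  "invariant_set f S \<longleftrightarrow> f ` S \<subseteq> S"

text \<open>
  The set \<open>B\<^sub>r(S)\<close>. The library sets \<open>infdist x {} = 0\<close>, so this is meaningful
  for nonempty \<open>S\<close> only.
\<close>

definition closed_nbhd :: "real \<Rightarrow> 'a::metric_space set \<Rightarrow> 'a set" where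
  "closed_nbhd r S = {x. infdist x S \<le> r}"

text \<open>
  A \<open>\<delta>\<close>-chain \<open>(x\<^sub>i)\<close>, \<open>0 \<le> i \<le> k\<close>, with all its points in \<open>S\<close>; the finite sequence is
  given by a function on \<open>nat\<close> of which only the values up to \<open>k\<close> are used.
\<close>

definition chain_in ::
    "('a::metric_space \<Rightarrow> 'a) \<Rightarrow> 'a set \<Rightarrow> real \<Rightarrow> nat \<Rightarrow> (nat \<Rightarrow> 'a) \<Rightarrow> bool" where
  "chain_in f S \<delta> k x \<longleftrightarrow>
     k \<ge> 1 \<and> (\<forall>i\<le>k. x i \<in> S) \<and> (\<forall>i<k. dist (f (x i)) (x (Suc i)) \<le> \<delta>)"

definition chain_reachable_in ::
    "('a::metric_space \<Rightarrow> 'a) \<Rightarrow> 'a set \<Rightarrow> 'a \<Rightarrow> 'a \<Rightarrow> bool" where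
  "chain_reachable_in f S x y \<longleftrightarrow>
     (\<forall>\<delta>>0. \<exists>k c. chain_in f S \<delta> k c \<and> c 0 = x \<and> c k = y)"

text \<open>
  Chain transitivity of the restriction of \<open>f\<close> to an \<open>f\<close>-invariant set \<open>S\<close>, as a map of
  the metric space \<open>S\<close> into itself; chains may only use points of \<open>S\<close>.
\<close>

definition chain_transitive_on :: "('a::metric_space \<Rightarrow> 'a) \<Rightarrow> 'a set \<Rightarrow> bool" where
  "chain_transitive_on f S \<longleftrightarrow> (\<forall>x\<in>S. \<forall>y\<in>S. chain_reachable_in f S x y)"

text \<open>In both shadowing properties the shadowing point need not lie in \<open>S\<close>.\<close>

definition shadowing_on :: "('a::metric_space \<Rightarrow> 'a) \<Rightarrow> 'a set \<Rightarrow> bool" where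
  "shadowing_on f S \<longleftrightarrow>
     (\<forall>\<epsilon>>0. \<exists>\<delta>>0. \<forall>k x. chain_in f S \<delta> k x \<longrightarrow>
        (\<exists>z. \<forall>i\<le>k. dist (x i) ((f ^^ i) z) \<le> \<epsilon>))"

text \<open>The integer iterate \<open>f\<^sup>i\<close> of a bijection \<open>f\<close>.\<close>

definition int_iterate :: "('a \<Rightarrow> 'a) \<Rightarrow> int \<Rightarrow> 'a \<Rightarrow> 'a" where
  "int_iterate f i = (if i \<ge> 0 then f ^^ nat i else inv f ^^ nat (- i))"

definition limit_pseudo_orbit ::
    "('a::metric_space \<Rightarrow> 'a) \<Rightarrow> real \<Rightarrow> (int \<Rightarrow> 'a) \<Rightarrow> bool" where
  "limit_pseudo_orbit f \<delta> x \<longleftrightarrow>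
     (\<forall>i. dist (f (x i)) (x (i + 1)) \<le> \<delta>) \<and>
     ((\<lambda>i. dist (f (x i)) (x (i + 1))) \<longlongrightarrow> 0) at_bot \<and>
     ((\<lambda>i. dist (f (x i)) (x (i + 1))) \<longlongrightarrow> 0) at_top"

definition L_shadowing_on :: "('a::metric_space \<Rightarrow> 'a) \<Rightarrow> 'a set \<Rightarrow> bool" where
  "L_shadowing_on f S \<longleftrightarrow>
     (\<forall>\<epsilon>>0. \<exists>\<delta>>0. \<forall>x. limit_pseudo_orbit f \<delta> x \<and> (\<forall>i. x i \<in> S) \<longrightarrow>
        (\<exists>z. (\<forall>i. dist (x i) (int_iterate f i z) \<le> \<epsilon>) \<and>
             ((\<lambda>i. dist (x i) (int_iterate f i z)) \<longlongrightarrow> 0) at_bot \<and>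
             ((\<lambda>i. dist (x i) (int_iterate f i z)) \<longlongrightarrow> 0) at_top))"

definition mixing :: "('a::topological_space \<Rightarrow> 'a) \<Rightarrow> bool" where
  "mixing f \<longleftrightarrow>
     (\<forall>U V. open U \<and> U \<noteq> {} \<and> open V \<and> V \<noteq> {} \<longrightarrow>
        (\<exists>j. \<forall>i\<ge>j. (f ^^ i) ` U \<inter> V \<noteq> {}))"

end

theory Submission
  imports Defs
begin

text \<open>
  Fix \<open>p\<close> in the interior of \<open>\<Lambda>\<close>. A point shadowing a chain in \<open>B\<^sub>b(\<Lambda>)\<close> that starts or ends at \<open>p\<close>
  has its orbit in \<open>\<Lambda>\<close>, so any \<open>x\<close> with \<open>p \<rightarrow> x\<close> or \<open>x \<rightarrow> p\<close> through chains in \<open>B\<^sub>b(\<Lambda>)\<close> lies in \<open>\<Lambda>\<close>.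
  If the forward orbit of \<open>w\<close> stays close to \<open>\<Lambda>\<close>, L-shadowing applied to the backward orbit of \<open>p\<close>,
  a chain from \<open>p\<close> to \<open>w\<close> and the forward orbit of \<open>w\<close> shows that \<open>w\<close> is forward asymptotic to \<open>\<Lambda>\<close>;
  hence \<open>w \<rightarrow> p\<close> and \<open>w \<in> \<Lambda>\<close>. Passing to backward limit points gives the same conclusion for
  backward orbits. If there were points outside \<open>\<Lambda>\<close> arbitrarily close to \<open>\<Lambda>\<close>, their backward orbits
  would have to leave a neighbourhood of \<open>\<Lambda>\<close> after arbitrarily long times, and a limit of the exit
  points would be a point outside \<open>\<Lambda>\<close> whose forward orbit stays close to \<open>\<Lambda>\<close>. So \<open>\<Lambda>\<close> is open.

  On a connected space chain transitivity improves to chain mixing, and shadowing turns chain mixing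
  into mixing.
\<close>

section \<open>Chains of prescribed length\<close>

text \<open>Endpoints and length are explicit because the mixing argument does arithmetic with chain
  lengths.\<close>

definition chain_of_length ::
    "('a::metric_space \<Rightarrow> 'a) \<Rightarrow> 'a set \<Rightarrow> real \<Rightarrow> nat \<Rightarrow> 'a \<Rightarrow> 'a \<Rightarrow> bool" where
  "chain_of_length f S \<delta> k x y \<longleftrightarrow> (\<exists>c. chain_in f S \<delta> k c \<and> c 0 = x \<and> c k = y)"

lemma chain_of_length_pos: "chain_of_length f S \<delta> k x y \<Longrightarrow> k \<ge> 1"
  by (auto simp: chain_of_length_def chain_in_def)

lemma chain_of_length_mono:
  "chain_of_length f S \<delta> k x y \<Longrightarrow> S \<subseteq> T \<Longrightarrow> \<delta> \<le> \<delta>' \<Longrightarrow> chain_of_length f T \<delta>' k x y"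
  unfolding chain_of_length_def chain_in_def
  by (metis order_trans subsetD)

lemma chain_of_length_append:
  assumes "chain_of_length f S \<delta> k x y" "chain_of_length f S \<delta> l y z"
  shows "chain_of_length f S \<delta> (k + l) x z"
proof -
  obtain c where c: "chain_in f S \<delta> k c" "c 0 = x" "c k = y"
    using assms(1) by (auto simp: chain_of_length_def)
  obtain d where d: "chain_in f S \<delta> l d" "d 0 = y" "d l = z"
    using assms(2) by (auto simp: chain_of_length_def)
  define e where "e i = (if i \<le> k then c i else d (i - k))" for i
  have "dist (f (e i)) (e (Suc i)) \<le> \<delta>" if "i < k + l" for i
  proof -
    consider "i < k" | "i = k" | "i > k" by linarith
    then show ?thesis
    proof cases
      case 2
      then show ?thesis using c d that by (auto simp: e_def chain_in_def)
    next
      case 3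
      then have "Suc i - k = Suc (i - k)" "i - k < l" using that by auto
      then show ?thesis using d 3 by (auto simp: e_def chain_in_def)
    qed (use c in \<open>auto simp: e_def chain_in_def\<close>)
  qed
  moreover have "e i \<in> S" if "i \<le> k + l" for i
    using c d that by (auto simp: e_def chain_in_def)
  ultimately have "chain_in f S \<delta> (k + l) e"
    using c(1) by (auto simp: chain_in_def)
  moreover have "e 0 = x" "e (k + l) = z"
    using c d by (auto simp: e_def chain_in_def)
  ultimately show ?thesis by (auto simp: chain_of_length_def)
qed

lemma chain_of_length_perturb_end:
  assumes "chain_of_length f S \<delta> k x y" "y' \<in> S" "dist y y' \<le> \<eta>"
  shows "chain_of_length f S (\<delta> + \<eta>) k x y'"
proof -
  obtain c where c: "chain_in f S \<delta> k c" "c 0 = x" "c k = y"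
    using assms(1) by (auto simp: chain_of_length_def)
  have "\<eta> \<ge> 0" using assms(3) zero_le_dist order_trans by blast
  have "dist (f (c i)) ((c(k := y')) (Suc i)) \<le> \<delta> + \<eta>" if "i < k" for i
  proof -
    have *: "dist (f (c i)) (c (Suc i)) \<le> \<delta>" using c that by (auto simp: chain_in_def)
    then show ?thesis
      using dist_triangle[of "f (c i)" y' y] c(3) assms(3) \<open>\<eta> \<ge> 0\<close> by auto
  qed
  then have "chain_in f S (\<delta> + \<eta>) k (c(k := y'))"
    using c assms by (auto simp: chain_in_def)
  then show ?thesis
    using c by (auto simp: chain_of_length_def chain_in_def intro!: exI[of _ "c(k := y')"])
qed

lemma chain_of_length_orbit:
  assumes "k \<ge> 1" "\<And>i. i \<le> k \<Longrightarrow> (f ^^ i) x \<in> S" "\<delta> \<ge> 0"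
  shows "chain_of_length f S \<delta> k x ((f ^^ k) x)"
  unfolding chain_of_length_def chain_in_def
  using assms by (intro exI[of _ "\<lambda>i. (f ^^ i) x"]) auto

lemma chain_transitive_on_chain_of_length:
  assumes "chain_transitive_on f S" "x \<in> S" "y \<in> S" "\<delta> > 0"
  shows "\<exists>k. chain_of_length f S \<delta> k x y"
  using assms by (auto simp: chain_transitive_on_def chain_reachable_in_def chain_of_length_def)

text \<open>A chain from \<open>y\<close> back to \<open>y\<close> has a last but one point in
  \<open>S\<close> whose image is close to \<open>y\<close>. So the image of \<open>S\<close> is
  dense in \<open>S\<close>, and by compactness it is closed.\<close>

lemma chain_transitive_on_image_eq:
  fixes f :: "'a::metric_space \<Rightarrow> 'a"
  assumes "compact S" "continuous_on S f" "f ` S \<subseteq> S" "chain_transitive_on f S"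
  shows "f ` S = S"
proof -
  have "y \<in> closure (f ` S)" if y: "y \<in> S" for y
    unfolding closure_approachable
  proof safe
    fix e :: real assume "e > 0"
    then obtain k where k: "chain_of_length f S (e/2) k y y"
      using chain_transitive_on_chain_of_length[OF assms(4) y y, of "e/2"] by auto
    obtain c where c: "chain_in f S (e/2) k c" "c k = y"
      using k by (auto simp: chain_of_length_def)
    have "k \<ge> 1" using k by (rule chain_of_length_pos)
    then have "k - 1 < k" "Suc (k - 1) = k" by simp_all
    then have "dist (f (c (k - 1))) (c k) \<le> e/2" "c (k - 1) \<in> S"
      using c(1) unfolding chain_in_def by (metis, simp)
    then show "\<exists>u\<in>f ` S. dist u y < e"
      using c \<open>k \<ge> 1\<close> \<open>e > 0\<close> by (intro bexI[of _ "f (c (k - 1))"]) auto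
  qed
  moreover have "closed (f ` S)"
    using assms by (intro compact_imp_closed compact_continuous_image)
  ultimately show ?thesis using assms(3) by auto
qed

section \<open>Points whose orbits stay near \<open>\<Lambda>\<close>\<close>

locale shadowed_chain_transitive_set =
  fixes f g :: "'a::metric_space \<Rightarrow> 'a" and \<Lambda> :: "'a set" and b :: real and p :: 'a
  assumes compact_UNIV: "compact (UNIV :: 'a set)"
    and homeo: "homeomorphism UNIV UNIV f g"
    and closed: "closed \<Lambda>"
    and invariant: "f ` \<Lambda> \<subseteq> \<Lambda>"
    and interior: "p \<in> interior \<Lambda>"
    and chain_transitive: "chain_transitive_on f \<Lambda>"
    and b_pos: "b > 0"
    and shadowing: "shadowing_on f (closed_nbhd b \<Lambda>)"
    and L_shadowing: "L_shadowing_on f (closed_nbhd b \<Lambda>)"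
begin

section \<open>Iterates and two-sided invariance of \<Lambda>\<close>

lemma gf [simp]: "g (f x) = x" and fg [simp]: "f (g x) = x"
  using homeo by (auto simp: homeomorphism_def)

lemma inv_f: "inv f = g"
  by (rule inv_equality) auto

lemma f_pow_g_pow: "i \<le> n \<Longrightarrow> (f ^^ i) ((g ^^ n) x) = (g ^^ (n - i)) x"
proof (induction i arbitrary: n)
  case (Suc i)
  then obtain m where "n = Suc m" using Suc_le_D by blast
  then show ?case using Suc by (simp add: funpow_swap1[of f])
qed simp

lemma continuous_on_f_pow: "continuous_on S (f ^^ i)"
proof (induction i)
  case (Suc i)
  have "continuous_on UNIV f" using homeo by (auto simp: homeomorphism_def)
  then show ?case unfolding funpow.simps
    using continuous_on_compose[OF Suc, of f] continuous_on_subset[OF _ subset_UNIV] by blast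
qed auto

lemma continuous_on_g_pow: "continuous_on S (g ^^ i)"
proof (induction i)
  case (Suc i)
  have "continuous_on UNIV g" using homeo by (auto simp: homeomorphism_def)
  then show ?case unfolding funpow.simps
    using continuous_on_compose[OF Suc, of g] continuous_on_subset[OF _ subset_UNIV] by blast
qed auto

lemma compact: "closed S \<Longrightarrow> compact S" for S :: "'a set"
  using compact_Int_closed[OF compact_UNIV, of S] by simp

lemma p_in: "p \<in> \<Lambda>"
  using interior interior_subset by blast

lemma nonempty: "\<Lambda> \<noteq> {}"
  using p_in by blast

lemma subset_closed_nbhd: "\<Lambda> \<subseteq> closed_nbhd b \<Lambda>"
  using b_pos by (auto simp: closed_nbhd_def)

lemma image_eq: "f ` \<Lambda> = \<Lambda>"
  using chain_transitive_on_image_eq[OF compact[OF closed] _ invariant chain_transitive]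
    continuous_on_f_pow[of \<Lambda> 1] by simp

text \<open>Membership passes backwards because \<Lambda> is its own image and \<open>f\<close> is
  injective. An orbit can thus be placed in \<Lambda> from any one of its points.\<close>

lemma f_in_iff: "f x \<in> \<Lambda> \<longleftrightarrow> x \<in> \<Lambda>"
  using image_eq by (metis gf image_iff)

lemma f_pow_in_iff: "(f ^^ i) x \<in> \<Lambda> \<longleftrightarrow> x \<in> \<Lambda>"
  by (induction i) (auto simp: f_in_iff)

lemma g_pow_in_iff: "(g ^^ i) x \<in> \<Lambda> \<longleftrightarrow> x \<in> \<Lambda>"
  using f_pow_in_iff[of i "(g ^^ i) x"] by (simp add: f_pow_g_pow)

lemma obtain_cball:
  obtains e where "e > 0" "cball p e \<subseteq> \<Lambda>"
  using interior by (auto simp: mem_interior_cball)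

section \<open>Membership in \<Lambda> through chains joined to \<open>p\<close>\<close>

lemma chains_from_p:
  assumes "\<And>\<delta>. \<delta> > 0 \<Longrightarrow> \<exists>k. chain_of_length f (closed_nbhd b \<Lambda>) \<delta> k p x"
  shows "x \<in> \<Lambda>"
proof -
  obtain e0 where e0: "e0 > 0" "cball p e0 \<subseteq> \<Lambda>" by (rule obtain_cball)
  have "\<exists>u\<in>\<Lambda>. dist u x < e" if "e > 0" for e
  proof -
    \<comment> \<open>Being at most \<open>e0\<close>, \<open>r\<close> forces the point shadowing
      \<open>p\<close> into \<Lambda>; being below \<open>e\<close>, it brings the point shadowing
      \<open>x\<close> close enough to \<open>x\<close>.\<close>
    define r where "r = min e0 (e/2)"
    have r: "r > 0" "r \<le> e0" "r < e" using e0 that by (auto simp: r_def)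
    obtain \<delta> where \<delta>: "\<delta> > 0" "\<And>k c. chain_in f (closed_nbhd b \<Lambda>) \<delta> k c \<Longrightarrow>
        \<exists>z. \<forall>i\<le>k. dist (c i) ((f ^^ i) z) \<le> r"
      using shadowing \<open>r > 0\<close> unfolding shadowing_on_def by metis
    obtain k c where c: "chain_in f (closed_nbhd b \<Lambda>) \<delta> k c" "c 0 = p" "c k = x"
      using assms[OF \<delta>(1)] by (auto simp: chain_of_length_def)
    obtain z where z: "\<And>i. i \<le> k \<Longrightarrow> dist (c i) ((f ^^ i) z) \<le> r"
      using \<delta>(2)[OF c(1)] by blast
    have "z \<in> \<Lambda>" using z[of 0] c(2) e0(2) r by auto
    then show ?thesis
      using z[of k] c(3) r by (intro bexI[of _ "(f ^^ k) z"]) (auto simp: f_pow_in_iff dist_commute)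
  qed
  then show ?thesis
    using closed closure_approachable[of x \<Lambda>] by auto
qed

text \<open>Mirror image of \<open>chains_from_p\<close>: the shadowing orbit is caught in \<Lambda>
  at its end and pulled back to its start.\<close>

lemma chains_to_p:
  assumes "\<And>\<delta>. \<delta> > 0 \<Longrightarrow> \<exists>k. chain_of_length f (closed_nbhd b \<Lambda>) \<delta> k x p"
  shows "x \<in> \<Lambda>"
proof -
  obtain e0 where e0: "e0 > 0" "cball p e0 \<subseteq> \<Lambda>" by (rule obtain_cball)
  have "\<exists>u\<in>\<Lambda>. dist u x < e" if "e > 0" for e
  proof -
    define r where "r = min e0 (e/2)"
    have r: "r > 0" "r \<le> e0" "r < e" using e0 that by (auto simp: r_def)
    obtain \<delta> where \<delta>: "\<delta> > 0" "\<And>k c. chain_in f (closed_nbhd b \<Lambda>) \<delta> k c \<Longrightarrow>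
        \<exists>z. \<forall>i\<le>k. dist (c i) ((f ^^ i) z) \<le> r"
      using shadowing \<open>r > 0\<close> unfolding shadowing_on_def by metis
    obtain k c where c: "chain_in f (closed_nbhd b \<Lambda>) \<delta> k c" "c 0 = x" "c k = p"
      using assms[OF \<delta>(1)] by (auto simp: chain_of_length_def)
    obtain z where z: "\<And>i. i \<le> k \<Longrightarrow> dist (c i) ((f ^^ i) z) \<le> r"
      using \<delta>(2)[OF c(1)] by blast
    have "(f ^^ k) z \<in> \<Lambda>" using z[of k] c(3) e0(2) r by auto
    then show ?thesis
      using z[of 0] c(2) r by (intro bexI[of _ z]) (auto simp: f_pow_in_iff dist_commute)
  qed
  then show ?thesis
    using closed closure_approachable[of x \<Lambda>] by auto
qed

lemma forward_orbit_near:
  obtains c where "c > 0" "c \<le> b"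
    "\<And>w. (\<And>n. infdist ((f ^^ n) w) \<Lambda> \<le> c) \<Longrightarrow> w \<in> \<Lambda>"
proof -
  let ?S = "closed_nbhd b \<Lambda>"
  obtain e0 where e0: "e0 > 0" "cball p e0 \<subseteq> \<Lambda>" by (rule obtain_cball)
  obtain \<delta> where \<delta>: "\<delta> > 0" and shadow:
    "\<And>x. limit_pseudo_orbit f \<delta> x \<Longrightarrow> (\<And>i. x i \<in> ?S) \<Longrightarrow>
        \<exists>z. (\<forall>i. dist (x i) (int_iterate f i z) \<le> e0) \<and>
             ((\<lambda>i. dist (x i) (int_iterate f i z)) \<longlongrightarrow> 0) at_top"
    using L_shadowing e0(1) unfolding L_shadowing_on_def by metis
  \<comment> \<open>The bound \<open>b\<close> keeps the orbit of \<open>w\<close> in the region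
    with shadowing; \<delta>/2 reserves half of the error for moving a chain's end from \<Lambda> to
    \<open>w\<close>.\<close>
  define c where "c = min b (\<delta>/2)"
  have c: "c > 0" "c \<le> b" "c \<le> \<delta>/2" using \<delta> b_pos by (auto simp: c_def)
  have "w \<in> \<Lambda>" if near: "\<And>n. infdist ((f ^^ n) w) \<Lambda> \<le> c" for w
  proof -
    have orbit: "(f ^^ n) w \<in> ?S" for n
      using near[of n] c by (auto simp: closed_nbhd_def)
    obtain y where y: "y \<in> \<Lambda>" and y_min: "\<And>u. u \<in> \<Lambda> \<Longrightarrow> dist w y \<le> dist w u"
      using continuous_attains_inf[OF compact[OF closed] nonempty continuous_on_dist[OF
          continuous_on_const continuous_on_id], of w] by blast
    have "dist w y \<le> infdist w \<Lambda>"
      unfolding infdist_notempty[OF nonempty] using nonempty y_min by (rule cINF_greatest)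
    then have "dist w y \<le> \<delta>/2" using near[of 0] c by simp
    obtain k where "chain_of_length f \<Lambda> (\<delta>/2) k p y"
      using chain_transitive_on_chain_of_length[OF chain_transitive p_in y, of "\<delta>/2"] \<delta> by auto
    from chain_of_length_mono[OF this subset_closed_nbhd order_refl]
    have "chain_of_length f ?S (\<delta>/2 + \<delta>/2) k p w"
      by (rule chain_of_length_perturb_end) (use \<open>dist w y \<le> \<delta>/2\<close> orbit[of 0] in \<open>auto simp: dist_commute\<close>)
    then obtain e where e: "chain_in f ?S \<delta> k e" "e 0 = p" "e k = w"
      by (auto simp: chain_of_length_def)
    \<comment> \<open>The three pieces agree at the seams \<open>0\<close> (value \<open>p\<close>)
      and \<open>int k\<close> (value \<open>w\<close>). Jumps can occur only for
      \<open>0 \<le> i < int k\<close>, so the errors vanish near both ends.\<close>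
    define x where "x i = (if i \<le> 0 then int_iterate f i p
      else if i \<le> int k then e (nat i) else (f ^^ (nat i - k)) w)" for i
    have step_neg: "f (x i) = x (i + 1)" if "i < 0" for i
    proof -
      have "nat (- i) = Suc (nat (- i - 1))" using that by auto
      moreover have "- (i + 1) = - i - 1" by simp
      ultimately show ?thesis using that
        by (cases "i = -1") (auto simp: x_def int_iterate_def inv_f)
    qed
    have x_nonneg: "x i = e (nat i)" if "0 \<le> i" "i \<le> int k" for i
      using that e(2) by (auto simp: x_def int_iterate_def)
    have x_ge: "x i = (f ^^ (nat i - k)) w" if "i \<ge> int k" for i
      using that e(2,3) by (auto simp: x_def int_iterate_def)
    have step_ge: "f (x i) = x (i + 1)" if "i \<ge> int k" for i
    proof -
      have "nat (i + 1) - k = Suc (nat i - k)" using that by auto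
      then show ?thesis using that by (simp add: x_ge)
    qed
    have step_mid: "dist (f (x i)) (x (i + 1)) \<le> \<delta>" if "0 \<le> i" "i < int k" for i
    proof -
      have "nat (i + 1) = Suc (nat i)" using that by auto
      moreover have "nat i < k" using that by auto
      ultimately show ?thesis using that e(1) by (auto simp: x_nonneg chain_in_def)
    qed
    have pseudo: "limit_pseudo_orbit f \<delta> x"
      unfolding limit_pseudo_orbit_def
    proof (intro conjI allI)
      show "dist (f (x i)) (x (i + 1)) \<le> \<delta>" for i
        using step_neg[of i] step_ge[of i] step_mid[of i] \<delta> by (cases "i < 0"; cases "i \<ge> int k") auto
      have "\<forall>\<^sub>F i in at_bot. dist (f (x i)) (x (i + 1)) = 0"
        using eventually_le_at_bot[of "- 1 :: int"] by eventually_elim (simp add: step_neg)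
      then show "((\<lambda>i. dist (f (x i)) (x (i + 1))) \<longlongrightarrow> 0) at_bot"
        by (rule tendsto_eventually)
      have "\<forall>\<^sub>F i in at_top. dist (f (x i)) (x (i + 1)) = 0"
        using eventually_ge_at_top[of "int k"] by eventually_elim (simp add: step_ge)
      then show "((\<lambda>i. dist (f (x i)) (x (i + 1))) \<longlongrightarrow> 0) at_top"
        by (rule tendsto_eventually)
    qed
    have "x i \<in> ?S" for i
    proof -
      consider "i < 0" | "0 \<le> i" "i \<le> int k" | "i \<ge> int k" by linarith
      then show ?thesis
      proof cases
        case 1
        then have "x i = (g ^^ nat (- i)) p" by (simp add: x_def int_iterate_def inv_f)
        then show ?thesis using g_pow_in_iff p_in subset_closed_nbhd by auto
      next
        case 2
        then show ?thesis using e(1) by (auto simp: x_nonneg chain_in_def)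
      next
        case 3
        then show ?thesis using orbit by (simp add: x_ge)
      qed
    qed
    then obtain z where z: "\<And>i. dist (x i) (int_iterate f i z) \<le> e0"
        "((\<lambda>i. dist (x i) (int_iterate f i z)) \<longlongrightarrow> 0) at_top"
      using shadow[OF pseudo] by blast
    have "x 0 = p" by (simp add: x_def int_iterate_def)
    then have "z \<in> \<Lambda>" using z(1)[of 0] e0(2) by (auto simp: int_iterate_def)
    show "w \<in> \<Lambda>"
    \<comment> \<open>The orbit of \<open>w\<close> is asymptotic to that of \<open>z\<close>, which
      lies in \<Lambda>. Follow \<open>w\<close> for a long time, jump to a point \<open>u\<close>
      of \<Lambda>, and return to \<open>p\<close> inside \<Lambda>.\<close>
    proof (rule chains_to_p)
      fix \<eta> :: real assume "\<eta> > 0"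
      then have "\<forall>\<^sub>F i in at_top. dist (x i) (int_iterate f i z) < \<eta>/2"
        using z(2) by (auto simp: tendsto_iff elim!: allE[of _ "\<eta>/2"])
      \<comment> \<open>The extra \<open>1\<close> gives \<open>n \<ge> 1\<close>, since a chain has
        at least one step.\<close>
      from eventually_happens[OF eventually_conj[OF this eventually_ge_at_top[of "int k + 1"]]]
      obtain i where i: "dist (x i) (int_iterate f i z) < \<eta>/2" "i > int k"
        by auto
      define n where "n = nat i - k"
      have n: "n \<ge> 1" "x i = (f ^^ n) w" using i by (auto simp: n_def x_ge)
      define u where "u = (f ^^ nat i) z"
      have u: "u \<in> \<Lambda>" "dist ((f ^^ n) w) u \<le> \<eta>/2"
        using i n \<open>z \<in> \<Lambda>\<close> by (auto simp: u_def f_pow_in_iff int_iterate_def)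
      have "chain_of_length f ?S (\<eta>/2) n w ((f ^^ n) w)"
        using n orbit \<open>\<eta> > 0\<close> by (intro chain_of_length_orbit) auto
      then have "chain_of_length f ?S (\<eta>/2 + \<eta>/2) n w u"
        by (rule chain_of_length_perturb_end) (use u subset_closed_nbhd in auto)
      moreover obtain m where "chain_of_length f \<Lambda> \<eta> m u p"
        using chain_transitive_on_chain_of_length[OF chain_transitive u(1) p_in \<open>\<eta> > 0\<close>]
        by blast
      from chain_of_length_mono[OF this subset_closed_nbhd order_refl]
      have "chain_of_length f ?S \<eta> m u p" .
      ultimately have "chain_of_length f ?S \<eta> (n + m) w p"
        using chain_of_length_append by fastforce
      then show "\<exists>k. chain_of_length f ?S \<eta> k w p" ..
    qed
  qed
  with c show ?thesis using that by blast
qed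

lemma backward_orbit_near:
  assumes c: "c \<le> b" "\<And>w. (\<And>n. infdist ((f ^^ n) w) \<Lambda> \<le> c) \<Longrightarrow> w \<in> \<Lambda>"
    and near: "\<And>n. infdist ((g ^^ n) x) \<Lambda> \<le> c"
  shows "x \<in> \<Lambda>"
proof -
  let ?S = "closed_nbhd b \<Lambda>"
  \<comment> \<open>For \<open>r n \<ge> i\<close>, taking \<open>i\<close> forward steps from
    \<open>(g ^^ r n) x\<close> stays on the backward orbit of \<open>x\<close>. Hence the whole
    forward orbit of the limit \<open>w\<close> is within \<open>c\<close> of \<Lambda>.\<close>
  obtain w r where r: "strict_mono r" and w: "(\<lambda>n. (g ^^ r n) x) \<longlonglongrightarrow> w"
    using compact_UNIV[unfolded compact_def, rule_format, of "\<lambda>n. (g ^^ n) x"]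
    by (auto simp: o_def)
  have "w \<in> \<Lambda>"
  proof (rule c(2))
    fix i
    have "(\<lambda>n. (f ^^ i) ((g ^^ r n) x)) \<longlonglongrightarrow> (f ^^ i) w"
      using continuous_on_tendsto_compose[OF continuous_on_f_pow[of UNIV] w] by auto
    then have "(\<lambda>n. infdist ((f ^^ i) ((g ^^ r n) x)) \<Lambda>) \<longlonglongrightarrow> infdist ((f ^^ i) w) \<Lambda>"
      by (rule tendsto_infdist)
    moreover have "infdist ((f ^^ i) ((g ^^ r n) x)) \<Lambda> \<le> c" if "n \<ge> i" for n
    proof -
      have "i \<le> r n" using that seq_suble[OF r, of n] by linarith
      then show ?thesis using near by (simp add: f_pow_g_pow)
    qed
    ultimately show "infdist ((f ^^ i) w) \<Lambda> \<le> c"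
      by (intro LIMSEQ_le_const2[where a = c]) auto
  qed
  show ?thesis
  proof (rule chains_from_p)
    fix \<eta> :: real assume "\<eta> > 0"
    then have "\<forall>\<^sub>F n in sequentially. dist ((g ^^ r n) x) w < \<eta>/2"
      using w by (auto simp: tendsto_iff elim!: allE[of _ "\<eta>/2"])
    from eventually_happens[OF eventually_conj[OF this eventually_ge_at_top[of 1]]]
    obtain n where n: "dist ((g ^^ r n) x) w < \<eta>/2" "n \<ge> 1" by auto
    have "r n \<ge> 1" using n seq_suble[OF r, of n] by linarith
    have "chain_of_length f ?S \<eta> (r n) ((g ^^ r n) x) ((f ^^ r n) ((g ^^ r n) x))"
      using \<open>r n \<ge> 1\<close> \<open>\<eta> > 0\<close> order_trans[OF near c(1)]
      by (intro chain_of_length_orbit) (auto simp: closed_nbhd_def f_pow_g_pow)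
    then have orbit: "chain_of_length f ?S \<eta> (r n) ((g ^^ r n) x) x"
      by (simp add: f_pow_g_pow)
    obtain k where "chain_of_length f \<Lambda> (\<eta>/2) k p w"
      using chain_transitive_on_chain_of_length[OF chain_transitive p_in \<open>w \<in> \<Lambda>\<close>, of "\<eta>/2"]
        \<open>\<eta> > 0\<close> by auto
    from chain_of_length_mono[OF this subset_closed_nbhd order_refl]
    have "chain_of_length f ?S (\<eta>/2 + \<eta>/2) k p ((g ^^ r n) x)"
      by (rule chain_of_length_perturb_end)
        (use n order_trans[OF near c(1)] in \<open>auto simp: closed_nbhd_def dist_commute\<close>)
    then have "chain_of_length f ?S \<eta> (k + r n) p x"
      using chain_of_length_append orbit by fastforce
    then show "\<exists>k. chain_of_length f ?S \<eta> k p x" ..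
  qed
qed

lemma open_set: "open \<Lambda>"
proof -
  obtain c where c: "c > 0" "c \<le> b" and
    fwd: "\<And>w. (\<And>n. infdist ((f ^^ n) w) \<Lambda> \<le> c) \<Longrightarrow> w \<in> \<Lambda>"
    by (rule forward_orbit_near) blast
  \<comment> \<open>Exit points: at distance at least \<open>c\<close> now, within \<open>c\<close>
    for the next \<open>n\<close> steps. The inequalities are weak so that these sets are
    closed.\<close>
  define K where
    "K n = {w. infdist w \<Lambda> \<ge> c} \<inter> (\<Inter>i\<in>{1..n}. {w. infdist ((f ^^ i) w) \<Lambda> \<le> c})" for n
  have closed_K: "closed (K n)" for n
    unfolding K_def by (intro closed_Int closed_INT ballI closed_Collect_le
      continuous_intros continuous_on_f_pow)
  have K_antimono: "K n \<subseteq> K m" if "m \<le> n" for m n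
    using that by (auto simp: K_def)
  have "\<Inter> (range K) = {}"
  proof (rule ccontr)
    assume "\<Inter> (range K) \<noteq> {}"
    then obtain w where w: "\<And>n. w \<in> K n" by blast
    have "f w \<in> \<Lambda>"
    proof (rule fwd)
      fix n
      show "infdist ((f ^^ n) (f w)) \<Lambda> \<le> c"
        using w[of "Suc n"] by (auto simp: K_def funpow_swap1 dest!: bspec[of _ _ "Suc n"])
    qed
    then have "infdist w \<Lambda> = 0" by (simp add: f_in_iff)
    then show False using w[of 0] c by (simp add: K_def)
  qed
  \<comment> \<open>Compactness and monotonicity yield a single \<open>N\<close> with
    \<open>K N\<close> empty.\<close>
  then obtain I where I: "finite I" "(\<Inter>n\<in>I. K n) = {}"
    using compact_imp_fip_image[of UNIV UNIV K, OF compact_UNIV closed_K] by auto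
  obtain N where "\<forall>n\<in>I. n \<le> N"
    using I(1) unfolding finite_nat_set_iff_bounded_le ..
  then have "K N \<subseteq> (\<Inter>n\<in>I. K n)"
    by (intro INT_greatest K_antimono) auto
  then have N: "K N = {}" using I(2) by simp
  define W where "W = (\<Inter>i\<in>{..N}. {x. infdist ((g ^^ i) x) \<Lambda> < c})"
  have "open W" unfolding W_def
    by (intro open_INT ballI open_Collect_less continuous_intros continuous_on_g_pow) auto
  moreover have "\<Lambda> \<subseteq> W"
    using c by (auto simp: W_def g_pow_in_iff)
  moreover have "W \<subseteq> \<Lambda>"
  proof
    fix x assume x: "x \<in> W"
    show "x \<in> \<Lambda>"
    proof (rule backward_orbit_near[OF c(2) fwd])
      fix n
      show "infdist ((g ^^ n) x) \<Lambda> \<le> c"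
      proof (rule ccontr)
        assume "\<not> ?thesis"
        then have ex: "\<exists>n. infdist ((g ^^ n) x) \<Lambda> > c" by (auto simp: not_le)
        \<comment> \<open>At the first backward exit time all later points of the orbit up to
          \<open>x\<close> are within \<open>c\<close>. Membership in \<open>W\<close> gives
          \<open>k > N\<close>, so the exit point would lie in \<open>K N\<close>.\<close>
        define k where "k = (LEAST n. infdist ((g ^^ n) x) \<Lambda> > c)"
        have k: "infdist ((g ^^ k) x) \<Lambda> > c"
          unfolding k_def using ex by (rule LeastI_ex)
        have below: "infdist ((g ^^ i) x) \<Lambda> \<le> c" if "i < k" for i
          using not_less_Least[of i "\<lambda>n. infdist ((g ^^ n) x) \<Lambda> > c"] that
          by (auto simp: k_def not_less)
        have "infdist ((g ^^ i) x) \<Lambda> < c" if "i \<le> N" for i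
          using x that by (simp add: W_def)
        from this[of k] have "k > N" using k by linarith
        have "(g ^^ k) x \<in> K N" unfolding K_def
        proof (intro IntI INT_I CollectI)
          fix i assume i: "i \<in> {1..N}"
          then have "(f ^^ i) ((g ^^ k) x) = (g ^^ (k - i)) x"
            using \<open>k > N\<close> by (intro f_pow_g_pow) auto
          then show "infdist ((f ^^ i) ((g ^^ k) x)) \<Lambda> \<le> c"
            using below[of "k - i"] i \<open>k > N\<close> by auto
        qed (use k in auto)
        then show False using N by blast
      qed
    qed
  qed
  ultimately show ?thesis by (metis subset_antisym)
qed

end

section \<open>Chain mixing on connected spaces\<close>

text \<open>Division by \<open>k\<close> gives \<open>n = q * k + r\<close> with
  \<open>r < k \<le> q\<close>; trading \<open>r\<close> copies of \<open>k\<close> for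
  \<open>Suc k\<close> gives \<open>n = (q - r) * k + r * Suc k\<close>.\<close>

lemma additive_consecutive_imp_eventually:
  fixes L :: "nat set"
  assumes add: "\<And>m n. m \<in> L \<Longrightarrow> n \<in> L \<Longrightarrow> m + n \<in> L"
    and k: "k \<in> L" "Suc k \<in> L" "k \<ge> 1" and n: "n \<ge> k * k"
  shows "n \<in> L"
proof -
  have mult: "j \<ge> 1 \<Longrightarrow> m \<in> L \<Longrightarrow> j * m \<in> L" for j m
    by (induction j rule: nat_induct_at_least) (auto intro: add)
  define q r where "q = n div k" and "r = n mod k"
  have qr: "n = q * k + r" "r < k" "k \<le> q"
    using k n by (auto simp: q_def r_def less_eq_div_iff_mult_less_eq)
  then have "n = (q - r) * k + r * Suc k"
    by (simp add: diff_mult_distrib)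
  moreover have "(q - r) * k \<in> L" using qr k by (intro mult) auto
  moreover have "r * Suc k \<in> L" if "r \<noteq> 0" using that k by (intro mult) auto
  \<comment> \<open>The case \<open>r = 0\<close> is separate because \<open>0\<close> need not
    belong to \<open>L\<close>.\<close>
  ultimately show ?thesis by (cases "r = 0") (auto intro: add)
qed

text \<open>
  \<open>D\<close> is the set of nonnegative differences of lengths of closed chains at \<open>x\<close>. The points reached
  from \<open>x\<close> by chains with length in \<open>D\<close> form a clopen set, which therefore contains \<open>f x\<close>; comparing
  with the chain of length 1 from \<open>x\<close> to \<open>f x\<close> gives \<open>1 \<in> D\<close>.
\<close>

lemma chain_transitive_connected_imp_chain_mixing:
  fixes f :: "'a::metric_space \<Rightarrow> 'a"
  assumes conn: "connected (UNIV :: 'a set)" and ct: "chain_transitive_on f UNIV" and \<delta>: "\<delta> > 0"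
  shows "\<exists>N. \<forall>n\<ge>N. chain_of_length f UNIV \<delta> n x y"
proof -
  let ?C = "chain_of_length f UNIV \<delta>"
  have trans: "\<exists>k. ?C k u v" for u v
    using chain_transitive_on_chain_of_length[OF ct, of u v \<delta>] \<delta> by auto
  have app: "?C k u v \<Longrightarrow> ?C l v w \<Longrightarrow> ?C (k + l) u w" for k l u v w
    by (rule chain_of_length_append)
  define L where "L = {n. ?C n x x}"
  have add: "m + n \<in> L" if "m \<in> L" "n \<in> L" for m n
    using that app by (auto simp: L_def)
  define D where "D = {n. \<exists>a\<in>L. a + n \<in> L}"
  have D_add: "m + n \<in> D" if mn: "m \<in> D" "n \<in> D" for m n
  proof -
    obtain a a' where "a \<in> L" "a + m \<in> L" "a' \<in> L" "a' + n \<in> L"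
      using mn by (auto simp: D_def)
    then have "a + a' \<in> L" "(a + m) + (a' + n) \<in> L" by (auto intro: add)
    then show ?thesis unfolding D_def
      by (auto simp: algebra_simps intro!: bexI[of _ "a + a'"])
  qed
  define A where "A = {y. \<exists>n\<in>D. ?C n x y}"
  \<comment> \<open>Inserting a loop at \<open>u\<close> into a closed chain at \<open>x\<close>
    shows that its length is in \<open>D\<close>. A loop with error \<delta>/2 can have its end
    moved to \<open>v\<close>. The uniform radius makes both \<open>A\<close> and its complement
    open.\<close>
  have A_nbhd: "v \<in> A" if u: "u \<in> A" and "dist u v \<le> \<delta>/2" for u v
  proof -
    obtain n where n: "n \<in> D" "?C n x u" using u by (auto simp: A_def)
    obtain l where l: "chain_of_length f UNIV (\<delta>/2) l u u"
      using chain_transitive_on_chain_of_length[OF ct, of u u "\<delta>/2"] \<delta> by auto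
    obtain t where t: "?C t u x" using trans by blast
    have "?C l u u" using chain_of_length_mono[OF l, of UNIV \<delta>] \<delta> by auto
    then have "n + t \<in> L" "(n + l) + t \<in> L"
      using app[OF n(2) t] app[OF app[OF n(2)] t] by (simp_all add: L_def)
    then have "l \<in> D"
      by (auto simp: D_def algebra_simps intro!: bexI[of _ "n + t"])
    moreover have "?C l u v"
      using chain_of_length_perturb_end[OF l, of v "\<delta>/2"] that by auto
    ultimately have "n + l \<in> D" "?C (n + l) x v"
      using app[OF n(2)] D_add[OF n(1)] by simp_all
    then show ?thesis unfolding A_def by blast
  qed
  have "open A"
    unfolding open_dist using A_nbhd \<delta> by (force simp: dist_commute intro!: exI[of _ "\<delta>/2"])
  moreover have "open (- A)"
    unfolding open_dist using A_nbhd \<delta> by (force intro!: exI[of _ "\<delta>/2"])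
  moreover have "x \<in> A"
  proof -
    obtain n where "?C n x x" using trans by blast
    then have "n \<in> L" "n + n \<in> L" by (auto simp: L_def intro: app)
    then show ?thesis using \<open>?C n x x\<close> by (auto simp: A_def D_def)
  qed
  ultimately have "A = UNIV"
    using conn[unfolded connected_clopen, rule_format, of A] by (auto simp: closed_def)
  then obtain n where n: "n \<in> D" "?C n x (f x)" by (auto simp: A_def)
  obtain a where a: "a \<in> L" "a + n \<in> L" using n by (auto simp: D_def)
  obtain t where t: "?C t (f x) x" using trans by blast
  have "?C 1 x (f x)" using chain_of_length_orbit[of 1 f x UNIV \<delta>] \<delta> by auto
  \<comment> \<open>Adding the loop lengths \<open>a + n\<close> and \<open>a\<close> crosswise
    cancels the unknown \<open>n\<close>: the two totals are consecutive integers.\<close>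
  then have "1 + t \<in> L" "n + t \<in> L" using app n(2) t by (auto simp only: L_def mem_Collect_eq)
  then have "(1 + t) + (a + n) \<in> L" "(n + t) + a \<in> L" using a add by blast+
  define k where "k = n + t + a"
  have k: "k \<in> L" "Suc k \<in> L"
    using \<open>(1 + t) + (a + n) \<in> L\<close> \<open>(n + t) + a \<in> L\<close> by (auto simp: k_def algebra_simps)
  have "k \<ge> 1" using k(1) chain_of_length_pos by (auto simp: L_def)
  obtain s where s: "?C s x y" using trans by blast
  have "?C n x y" if "n \<ge> k * k + s" for n
  proof -
    have "k * k \<le> n - s" using that by linarith
    with add k \<open>k \<ge> 1\<close> have "n - s \<in> L" by (rule additive_consecutive_imp_eventually)
    then have "?C ((n - s) + s) x y" using app[OF _ s] by (simp add: L_def)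
    then show ?thesis using that by simp
  qed
  then show ?thesis by blast
qed

lemma shadowing_chain_transitive_connected_imp_mixing:
  fixes f :: "'a::metric_space \<Rightarrow> 'a"
  assumes "connected (UNIV :: 'a set)" "chain_transitive_on f UNIV" "shadowing_on f UNIV"
  shows "mixing f"
  unfolding mixing_def
proof (intro allI impI)
  fix U V :: "'a set"
  assume UV: "open U \<and> U \<noteq> {} \<and> open V \<and> V \<noteq> {}"
  then obtain u v where u: "u \<in> U" and v: "v \<in> V" by blast
  obtain e1 where e1: "e1 > 0" "cball u e1 \<subseteq> U"
    using UV u by (meson open_contains_cball)
  obtain e2 where e2: "e2 > 0" "cball v e2 \<subseteq> V"
    using UV v by (meson open_contains_cball)
  \<comment> \<open>One radius serves both ends: the shadowing point starts in \<open>U\<close> and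
    is in \<open>V\<close> after \<open>n\<close> steps.\<close>
  define e where "e = min e1 e2"
  have "e > 0" using e1 e2 by (simp add: e_def)
  then obtain \<delta> where \<delta>: "\<delta> > 0" "\<And>k c. chain_in f UNIV \<delta> k c \<Longrightarrow>
      \<exists>z. \<forall>i\<le>k. dist (c i) ((f ^^ i) z) \<le> e"
    using assms(3) unfolding shadowing_on_def by metis
  obtain N where N: "\<And>n. n \<ge> N \<Longrightarrow> chain_of_length f UNIV \<delta> n u v"
    using chain_transitive_connected_imp_chain_mixing[OF assms(1,2) \<delta>(1)] by blast
  have "(f ^^ n) ` U \<inter> V \<noteq> {}" if n: "n \<ge> N" for n
  proof -
    obtain c where c: "chain_in f UNIV \<delta> n c" "c 0 = u" "c n = v"
      using N[OF n] by (auto simp: chain_of_length_def)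
    obtain z where z: "\<And>i. i \<le> n \<Longrightarrow> dist (c i) ((f ^^ i) z) \<le> e"
      using \<delta>(2)[OF c(1)] by blast
    have "z \<in> U" using z[of 0] c(2) e1(2) by (auto simp: e_def)
    moreover have "(f ^^ n) z \<in> V" using z[of n] c(3) e2(2) by (auto simp: e_def)
    ultimately show ?thesis by blast
  qed
  then show "\<exists>j. \<forall>i\<ge>j. (f ^^ i) ` U \<inter> V \<noteq> {}" by blast
qed

theorem theorem1p1:
  fixes f :: "'a::metric_space \<Rightarrow> 'a" and \<Lambda> :: "'a set" and b :: real
  assumes "compact (UNIV :: 'a set)"
    and "self_homeomorphism f"
    and "closed \<Lambda>" and "invariant_set f \<Lambda>"
    and "interior \<Lambda> \<noteq> {}"
    and "chain_transitive_on f \<Lambda>"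
    and "b > 0"
    and "shadowing_on f (closed_nbhd b \<Lambda>)"
    and "L_shadowing_on f (closed_nbhd b \<Lambda>)"
  shows "open \<Lambda> \<and> closed \<Lambda> \<and>
    (connected (UNIV :: 'a set) \<longrightarrow> \<Lambda> = UNIV \<and> self_homeomorphism f \<and> mixing f)"
proof -
  obtain g where "homeomorphism UNIV UNIV f g"
    using assms(2) by (auto simp: self_homeomorphism_def)
  moreover obtain p where "p \<in> interior \<Lambda>" using assms(5) by blast
  ultimately interpret shadowed_chain_transitive_set f g \<Lambda> b p
    using assms by unfold_locales (auto simp: invariant_set_def)
  have "\<Lambda> = UNIV" if "connected (UNIV :: 'a set)"
    using that[unfolded connected_clopen, rule_format, of \<Lambda>] open_set closed nonempty by auto
  moreover have "mixing f" if conn: "connected (UNIV :: 'a set)" and eq: "\<Lambda> = UNIV"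
  proof (rule shadowing_chain_transitive_connected_imp_mixing[OF conn])
    show "chain_transitive_on f UNIV" using chain_transitive eq by simp
    have "closed_nbhd b \<Lambda> = UNIV" using subset_closed_nbhd eq by auto
    then show "shadowing_on f UNIV" using shadowing by simp
  qed
  ultimately show ?thesis using open_set closed assms(2) by blast
qed

end
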